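(* There is a computable function $f$ such that for every $e$, if $e$ is an index for a computable $2$-coloring $c:[\mathbb{N}]^2\to\{\text{BLUE},\text{RED}\}$, then either $f(e)$ is an index for a $\Delta^0_2$ path decomposition for $c$, or there is a computable path decomposition for $c$ in which one of the two paths is finite.
   Context: A (monochromatic) path of color $k$ is a finite or infinite list of distinct natural numbers in which every two consecutive elements form a pair of color $k$ (empty and one-element lists are paths of every color). A path decomposition for a $2$-coloring $c$ is a BLUE path and a RED path such that every natural number lies on exactly one of them. An index for a computable coloring $c$ is a number $e$ such that $\varphi_e$ computes $c$. A $\Delta^0_2$ path decomposition for $c$ is a pair $(P_b,P_r)$ of partial $\emptyset'$-computable functions whose domains are initial segments of $\mathbb{N}$, whose ranges partition $\mathbb{N}$, such that $c(\{P_b(n),P_b(n+1)\})$ is BLUE whenever $n+1\in\mathrm{dom}(P_b)$ and $c(\{P_r(n),P_r(n+1)\})$ is RED whenever $n+1\in\mathrm{dom}(P_r)$. An index for such a decomposition is (a code for) a pair $(i_b,i_r)$ with $\Phi_{i_b}^{\emptyset'}=P_b$ and $\Phi_{i_r}^{\emptyset'}=P_r$. *)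

theory Defs
  imports "HOL-Library.Nat_Bijection"
begin

text \<open>
  Partial recursive functions relative to a set \<open>A\<close>, presented as in Kleene's definition
  except that all functions are unary: several arguments are passed as one number by means of
  the pairing function \<^const>\<open>prod_encode\<close>. \<open>Query\<close> is the characteristic function of \<open>A\<close>.
\<close>

datatype prog =
    Zero
  | Succ
  | First
  | Second
  | Query
  | Tuple prog prog
  | Compose prog prog
  | Recurse prog prog
  | Minimize prog

text \<open>The search diverges if it meets an undefined value before the first zero.\<close>

definition minimize :: "(nat \<Rightarrow> nat option) \<Rightarrow> nat option" where
  "minimize h =
     (if \<exists>n. h n = Some 0 \<and> (\<forall>m<n. h m \<noteq> None)
      then Some (LEAST n. h n = Some 0) else None)"

primrec eval :: "nat set \<Rightarrow> prog \<Rightarrow> nat \<Rightarrow> nat option" where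
  "eval A Zero x = Some 0"
| "eval A Succ x = Some (Suc x)"
| "eval A First x = Some (fst (prod_decode x))"
| "eval A Second x = Some (snd (prod_decode x))"
| "eval A Query x = Some (if x \<in> A then 1 else 0)"
| "eval A (Tuple p q) x =
     Option.bind (eval A p x) (\<lambda>u. Option.bind (eval A q x) (\<lambda>v. Some (prod_encode (u, v))))"
| "eval A (Compose p q) x = Option.bind (eval A q x) (eval A p)"
| "eval A (Recurse p q) x =
     (case prod_decode x of (a, n) \<Rightarrow>
        rec_nat (eval A p a)
          (\<lambda>m r. Option.bind r (\<lambda>v. eval A q (prod_encode (a, prod_encode (m, v))))) n)"
| "eval A (Minimize p) x = minimize (\<lambda>n. eval A p (prod_encode (x, n)))"

primrec prog_code :: "prog \<Rightarrow> nat" where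
  "prog_code Zero = 0"
| "prog_code Succ = 1"
| "prog_code First = 2"
| "prog_code Second = 3"
| "prog_code Query = 4"
| "prog_code (Tuple p q) = 5 + 4 * prod_encode (prog_code p, prog_code q)"
| "prog_code (Compose p q) = 6 + 4 * prod_encode (prog_code p, prog_code q)"
| "prog_code (Recurse p q) = 7 + 4 * prod_encode (prog_code p, prog_code q)"
| "prog_code (Minimize p) = 8 + 4 * prog_code p"

lemma inj_prog_code: "inj prog_code"
proof (rule injI)
  fix p q assume "prog_code p = prog_code q"
  then show "p = q"
  proof (induction p arbitrary: q)
    case Zero then show ?case by (cases q) auto
  next
    case Succ then show ?case by (cases q) auto
  next
    case First then show ?case by (cases q) auto
  next
    case Second then show ?case by (cases q) auto
  next
    case Query then show ?case by (cases q) auto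
  next
    case (Tuple p1 p2) then show ?case by (cases q) (simp_all, presburger+)
  next
    case (Compose p1 p2) then show ?case by (cases q) (simp_all, presburger+)
  next
    case (Recurse p1 p2) then show ?case by (cases q) (simp_all, presburger+)
  next
    case (Minimize p) then show ?case by (cases q) (simp_all, presburger+)
  qed
qed

lemma surj_prog_code: "surj prog_code"
proof -
  have "\<exists>p. prog_code p = n" for n
  proof (induction n rule: less_induct)
    case (less n)
    show ?case
    proof (cases "n < 5")
      case True
      then have "n = 0 \<or> n = 1 \<or> n = 2 \<or> n = 3 \<or> n = 4" by arith
      then show ?thesis
        by (metis prog_code.simps(1-5))
    next
      case False
      define k where "k = (n - 5) div 4"
      obtain a b where ab: "prod_decode k = (a, b)" by (cases "prod_decode k")
      then have k: "k = prod_encode (a, b)" by (metis prod_decode_inverse)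
      have "k < n" using False unfolding k_def by linarith
      moreover have "a \<le> k" "b \<le> k"
        using k le_prod_encode_1 le_prod_encode_2 by auto
      ultimately obtain p q r where
        "prog_code p = a" "prog_code q = b" "prog_code r = k"
        by (meson less le_less_trans)
      moreover have "n = 5 + 4 * k \<or> n = 6 + 4 * k \<or> n = 7 + 4 * k \<or> n = 8 + 4 * k"
        using False unfolding k_def by linarith
      ultimately show ?thesis
        using k by (metis prog_code.simps(6-9))
    qed
  qed
  then show ?thesis by (metis surjI)
qed

lemma bij_prog_code: "bij prog_code"
  using inj_prog_code surj_prog_code by (rule bijI)

text \<open>\<open>Phi A e\<close> is the \<open>e\<close>-th partial \<open>A\<close>-computable function; every number is an index,
  by \<open>bij_prog_code\<close>.\<close>

definition Phi :: "nat set \<Rightarrow> nat \<Rightarrow> nat \<Rightarrow> nat option" where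
  "Phi A e = eval A (inv prog_code e)"

abbreviation phi :: "nat \<Rightarrow> nat \<Rightarrow> nat option" where
  "phi \<equiv> Phi {}"

definition jump :: "nat set \<Rightarrow> nat set" where
  "jump A = {e. Phi A e e \<noteq> None}"

definition partial_computable_in :: "nat set \<Rightarrow> (nat \<Rightarrow> nat option) \<Rightarrow> bool" where
  "partial_computable_in A h \<longleftrightarrow> (\<exists>e. Phi A e = h)"

definition computable :: "(nat \<Rightarrow> nat) \<Rightarrow> bool" where
  "computable f \<longleftrightarrow> partial_computable_in {} (\<lambda>x. Some (f x))"

datatype color = BLUE | RED

fun color_code :: "color \<Rightarrow> nat" where
  "color_code BLUE = 0"
| "color_code RED = 1"

text \<open>
  A coloring of the two-element sets of natural numbers is a function on all sets; its values
  on other sets are never used. The pair \<open>{x, y}\<close> with \<open>x < y\<close> is presented to a program as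
  \<open>prod_encode (x, y)\<close>; inputs coding no such pair are unconstrained.
\<close>

type_synonym coloring = "nat set \<Rightarrow> color"

definition coloring_index :: "nat \<Rightarrow> coloring \<Rightarrow> bool" where
  "coloring_index e c \<longleftrightarrow>
     (\<forall>x y. x < y \<longrightarrow> phi e (prod_encode (x, y)) = Some (color_code (c {x, y})))"

text \<open>A finite or infinite list is a partial function whose domain is an initial segment.\<close>

definition initial_segment :: "nat set \<Rightarrow> bool" where
  "initial_segment D \<longleftrightarrow> (\<forall>n\<in>D. \<forall>m<n. m \<in> D)"

definition path :: "coloring \<Rightarrow> color \<Rightarrow> (nat \<Rightarrow> nat option) \<Rightarrow> bool" where
  "path c k P \<longleftrightarrow>
     initial_segment (dom P) \<and> inj_on P (dom P) \<and>
     (\<forall>n. Suc n \<in> dom P \<longrightarrow> c {the (P n), the (P (Suc n))} = k)"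

definition path_decomposition ::
    "coloring \<Rightarrow> (nat \<Rightarrow> nat option) \<Rightarrow> (nat \<Rightarrow> nat option) \<Rightarrow> bool" where
  "path_decomposition c Pb Pr \<longleftrightarrow>
     path c BLUE Pb \<and> path c RED Pr \<and> ran Pb \<union> ran Pr = UNIV \<and> ran Pb \<inter> ran Pr = {}"

definition path_decomposition_in ::
    "nat set \<Rightarrow> coloring \<Rightarrow> (nat \<Rightarrow> nat option) \<Rightarrow> (nat \<Rightarrow> nat option) \<Rightarrow> bool" where
  "path_decomposition_in A c Pb Pr \<longleftrightarrow>
     path_decomposition c Pb Pr \<and> partial_computable_in A Pb \<and> partial_computable_in A Pr"

abbreviation computable_path_decomposition ::
    "coloring \<Rightarrow> (nat \<Rightarrow> nat option) \<Rightarrow> (nat \<Rightarrow> nat option) \<Rightarrow> bool" where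
  "computable_path_decomposition \<equiv> path_decomposition_in {}"

abbreviation Delta2_path_decomposition ::
    "coloring \<Rightarrow> (nat \<Rightarrow> nat option) \<Rightarrow> (nat \<Rightarrow> nat option) \<Rightarrow> bool" where
  "Delta2_path_decomposition \<equiv> path_decomposition_in (jump {})"

definition Delta2_path_decomposition_index :: "nat \<Rightarrow> coloring \<Rightarrow> bool" where
  "Delta2_path_decomposition_index i c \<longleftrightarrow>
     (\<exists>ib ir Pb Pr. i = prod_encode (ib, ir) \<and>
        Phi (jump {}) ib = Pb \<and> Phi (jump {}) ir = Pr \<and> Delta2_path_decomposition c Pb Pr)"

end

theory Submission
  imports Defs "HOL-Library.Infinite_Set" "HOL-Library.Sublist"
begin

text \<open>
  Call a vertex stable in a color if that color joins it to almost all vertices. Suppose that each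
  color has infinitely many stable vertices. Keep two finite paths, each ending in a vertex
  that is stable in its color. A new vertex \<open>v\<close> has infinitely many neighbors in some color \<open>k\<close>, so
  the path of color \<open>k\<close> can be continued through a common neighbor to \<open>v\<close>, and from there through
  another one to a fresh stable vertex. Stability with a given bound is one question to the
  halting problem, so the search for the next pair of paths is \<open>\<Delta>\<^sup>0\<^sub>2\<close>, uniformly in the index.

  If color \<open>k\<close> has only finitely many stable vertices, then there is a finite path of some color such
  that every finite path of the other color in its complement can be extended there to any given
  vertex, and a plain search yields a computable decomposition. Take a path of color \<open>k\<close> through
  all vertices stable in \<open>k\<close>. If extension fails, then color \<open>k\<close> contains a complete bipartite
  graph with infinite sides on almost all vertices; now only finitely many vertices are stable in the
  other color, and a path through these will do because every remaining vertex has infinitely many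
  neighbors of color \<open>k\<close> in the bipartite graph.
\<close>

subsection \<open>Uniform computability\<close>

lemma inv_prog_code [simp]: "inv prog_code (prog_code p) = p"
  by (simp add: inj_prog_code)

lemma prog_code_inv [simp]: "prog_code (inv prog_code e) = e"
  by (simp add: surj_prog_code surj_f_inv_f)

lemma Phi_prog_code [simp]: "Phi A (prog_code p) = eval A p"
  by (simp add: Phi_def)

lemma computable_iff: "computable f \<longleftrightarrow> (\<exists>p. \<forall>x. eval {} p x = Some (f x))"
  unfolding computable_def partial_computable_in_def by (metis Phi_def Phi_prog_code ext)

lemma computable_Suc: "computable f \<Longrightarrow> computable (\<lambda>e. Suc (f e))"
  unfolding computable_iff
  by (metis bind.bind_lunit eval.simps(2) eval.simps(7))

lemma computable_id: "computable (\<lambda>e. e)"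
proof -
  have "\<forall>x. eval {} (Tuple First Second) x = Some x" by simp
  then show ?thesis unfolding computable_iff by blast
qed

lemma computable_compose:
  assumes "computable f" "computable g" shows "computable (\<lambda>e. f (g e))"
proof -
  obtain p q where "\<forall>x. eval {} p x = Some (f x)" "\<forall>x. eval {} q x = Some (g x)"
    using assms unfolding computable_iff by blast
  then have "\<forall>x. eval {} (Compose p q) x = Some (f (g x))" by simp
  then show ?thesis unfolding computable_iff by blast
qed

lemma computable_pair:
  assumes "computable f" "computable g" shows "computable (\<lambda>e. prod_encode (f e, g e))"
proof -
  obtain p q where "\<forall>x. eval {} p x = Some (f x)" "\<forall>x. eval {} q x = Some (g x)"
    using assms unfolding computable_iff by blast
  then have "\<forall>x. eval {} (Tuple p q) x = Some (prod_encode (f x, g x))" by simp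
  then show ?thesis unfolding computable_iff by blast
qed

lemma computable_add:
  assumes "computable f" "computable g" shows "computable (\<lambda>e. f e + g e)"
proof -
  let ?p = "Recurse (Tuple First Second) (Compose Succ (Compose Second Second))"
  have "eval {} ?p (prod_encode (a, n)) = Some (a + n)" for a n
    by (induction n) simp_all
  then have "computable (\<lambda>x. fst (prod_decode x) + snd (prod_decode x))"
    unfolding computable_iff by (metis prod_decode_inverse prod.collapse)
  from computable_compose[OF this computable_pair[OF assms]] show ?thesis by simp
qed

lemma computable_const: "computable (\<lambda>e. k)"
proof (induction k)
  case 0
  have "\<forall>x. eval {} Zero x = Some 0" by simp
  then show ?case unfolding computable_iff by blast
qed (rule computable_Suc)

text \<open>Codes of compound programs have the shape \<open>k + 4 * ...\<close>, so this makes the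
  assembly of programs from parts computable. The multiple is written as a sum to reduce it to
  addition.\<close>

lemma computable_code: "computable f \<Longrightarrow> computable (\<lambda>e. k + 4 * f e)"
  using computable_add[OF computable_const[of k] computable_add[OF computable_add computable_add, of f f f f]]
  by (simp add: numeral_eq_Suc add.assoc)

lemma Phi_Tuple: "Phi A (5 + 4 * prod_encode (a, b)) = eval A (Tuple (inv prog_code a) (inv prog_code b))"
  using Phi_prog_code[of A "Tuple (inv prog_code a) (inv prog_code b)"]
  by (simp del: Phi_prog_code)

lemma Phi_Compose: "Phi A (6 + 4 * prod_encode (a, b)) = eval A (Compose (inv prog_code a) (inv prog_code b))"
  using Phi_prog_code[of A "Compose (inv prog_code a) (inv prog_code b)"]
  by (simp del: Phi_prog_code)

lemma Phi_Recurse: "Phi A (7 + 4 * prod_encode (a, b)) = eval A (Recurse (inv prog_code a) (inv prog_code b))"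
  using Phi_prog_code[of A "Recurse (inv prog_code a) (inv prog_code b)"]
  by (simp del: Phi_prog_code)

lemma Phi_Minimize: "Phi A (8 + 4 * a) = eval A (Minimize (inv prog_code a))"
  using Phi_prog_code[of A "Minimize (inv prog_code a)"]
  by (simp del: Phi_prog_code)

text \<open>The index transformation \<open>t\<close> is total and computable without the oracle,
  while its values are constrained only on \<open>E\<close>. Thus no test for membership in
  \<open>E\<close> ever has to be made.\<close>

definition uniformly_computable_in ::
    "nat set \<Rightarrow> nat set \<Rightarrow> (nat \<Rightarrow> nat \<Rightarrow> nat) \<Rightarrow> bool" where
  "uniformly_computable_in A E F \<longleftrightarrow>
     (\<exists>t. computable t \<and> (\<forall>e\<in>E. \<forall>x. Phi A (t e) x = Some (F e x)))"

lemma uc_prog: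
  assumes "\<And>e x. e \<in> E \<Longrightarrow> eval A p x = Some (F e x)" shows "uniformly_computable_in A E F"
  unfolding uniformly_computable_in_def
  by (rule exI[of _ "\<lambda>e. prog_code p"]) (simp add: computable_const assms)

lemma uc_id: "uniformly_computable_in A E (\<lambda>e x. x)"
  by (rule uc_prog[of _ _ "Tuple First Second"]) simp

lemma uc_compose:
  assumes "uniformly_computable_in A E F" "uniformly_computable_in A E G"
  shows "uniformly_computable_in A E (\<lambda>e x. F e (G e x))"
proof -
  obtain s t where "computable s" "\<forall>e\<in>E. \<forall>x. Phi A (s e) x = Some (F e x)"
      "computable t" "\<forall>e\<in>E. \<forall>x. Phi A (t e) x = Some (G e x)"
    using assms unfolding uniformly_computable_in_def by blast
  then show ?thesis unfolding uniformly_computable_in_def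
    by (intro exI[of _ "\<lambda>e. 6 + 4 * prod_encode (s e, t e)"] conjI computable_code computable_pair)
       (simp_all add: Phi_Compose, simp add: Phi_def)
qed

lemma uc_pair:
  assumes "uniformly_computable_in A E F" "uniformly_computable_in A E G"
  shows "uniformly_computable_in A E (\<lambda>e x. prod_encode (F e x, G e x))"
proof -
  obtain s t where "computable s" "\<forall>e\<in>E. \<forall>x. Phi A (s e) x = Some (F e x)"
      "computable t" "\<forall>e\<in>E. \<forall>x. Phi A (t e) x = Some (G e x)"
    using assms unfolding uniformly_computable_in_def by blast
  then show ?thesis unfolding uniformly_computable_in_def
    by (intro exI[of _ "\<lambda>e. 5 + 4 * prod_encode (s e, t e)"] conjI computable_code computable_pair)
       (simp_all add: Phi_Tuple, simp add: Phi_def)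
qed

lemma uc_0: "uniformly_computable_in A E (\<lambda>e x. 0)"
  by (rule uc_prog[of _ _ Zero]) simp

lemma uc_Suc: "uniformly_computable_in A E F \<Longrightarrow> uniformly_computable_in A E (\<lambda>e x. Suc (F e x))"
  by (rule uc_compose[of _ _ "\<lambda>e. Suc"]) (auto intro: uc_prog[of _ _ Succ])

lemma uc_fst:
  "uniformly_computable_in A E F \<Longrightarrow> uniformly_computable_in A E (\<lambda>e x. fst (prod_decode (F e x)))"
  by (rule uc_compose[of _ _ "\<lambda>e x. fst (prod_decode x)"]) (auto intro: uc_prog[of _ _ First])

lemma uc_snd:
  "uniformly_computable_in A E F \<Longrightarrow> uniformly_computable_in A E (\<lambda>e x. snd (prod_decode (F e x)))"
  by (rule uc_compose[of _ _ "\<lambda>e x. snd (prod_decode x)"]) (auto intro: uc_prog[of _ _ Second])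

lemma uc_const: "uniformly_computable_in A E (\<lambda>e x. k)"
  by (induction k) (auto intro: uc_0 uc_Suc)

lemma uc_rec:
  assumes "uniformly_computable_in A E G" "uniformly_computable_in A E N"
    "uniformly_computable_in A E (\<lambda>e z. H e (fst (prod_decode z))
        (fst (prod_decode (snd (prod_decode z)))) (snd (prod_decode (snd (prod_decode z)))))"
  shows "uniformly_computable_in A E (\<lambda>e x. rec_nat (G e x) (H e x) (N e x))"
proof -
  obtain s t where s: "computable s" "\<forall>e\<in>E. \<forall>x. Phi A (s e) x = Some (G e x)"
      and t: "computable t" "\<forall>e\<in>E. \<forall>z. Phi A (t e) z = Some (H e (fst (prod_decode z))
        (fst (prod_decode (snd (prod_decode z)))) (snd (prod_decode (snd (prod_decode z)))))"
    using assms(1,3) unfolding uniformly_computable_in_def by blast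
  have "Phi A (7 + 4 * prod_encode (s e, t e)) x =
      Some (rec_nat (G e (fst (prod_decode x))) (H e (fst (prod_decode x))) (snd (prod_decode x)))"
    if "e \<in> E" for e x
  proof -
    obtain a n where x: "prod_decode x = (a, n)" by fastforce
    show ?thesis
      using s(2) t(2) that unfolding Phi_Recurse
      by (simp add: x) (induction n, simp_all add: Phi_def)
  qed
  then have "uniformly_computable_in A E (\<lambda>e x.
      rec_nat (G e (fst (prod_decode x))) (H e (fst (prod_decode x))) (snd (prod_decode x)))"
    unfolding uniformly_computable_in_def
    using s(1) t(1) by (intro exI[of _ "\<lambda>e. 7 + 4 * prod_encode (s e, t e)"] conjI
        computable_code computable_pair) auto
  \<comment> \<open>The input of \<open>Recurse\<close> pairs a parameter with a counter: here
    \<open>x\<close> itself is the parameter and \<open>N e x\<close> the number of rounds.\<close>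
  from uc_compose[OF this uc_pair[OF uc_id assms(2)]] show ?thesis by simp
qed

lemma minimize_Some:
  "minimize (\<lambda>n. Some (h n)) = (if \<exists>n. h n = 0 then Some (LEAST n. h n = 0) else None)"
  by (simp add: minimize_def)

lemma uc_Least:
  assumes "uniformly_computable_in A E (\<lambda>e z. P e (fst (prod_decode z)) (snd (prod_decode z)))"
    and ex: "\<And>e x. e \<in> E \<Longrightarrow> \<exists>n. P e x n = 0"
  shows "uniformly_computable_in A E (\<lambda>e x. LEAST n. P e x n = 0)"
proof -
  obtain t where t: "computable t"
      "\<forall>e\<in>E. \<forall>z. Phi A (t e) z = Some (P e (fst (prod_decode z)) (snd (prod_decode z)))"
    using assms(1) unfolding uniformly_computable_in_def by blast
  then show ?thesis unfolding uniformly_computable_in_def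
    using ex by (intro exI[of _ "\<lambda>e. 8 + 4 * t e"] conjI computable_code)
      (auto simp add: Phi_Minimize minimize_Some simp flip: Phi_def)
qed

text \<open>Truth is coded by 0 because \<open>Minimize\<close> searches for a zero.\<close>

definition uniformly_decidable_in ::
    "nat set \<Rightarrow> nat set \<Rightarrow> (nat \<Rightarrow> nat \<Rightarrow> bool) \<Rightarrow> bool" where
  "uniformly_decidable_in A E P \<longleftrightarrow>
     uniformly_computable_in A E (\<lambda>e x. if P e x then 0 else 1)"

lemma uc_if:
  assumes "uniformly_decidable_in A E P" "uniformly_computable_in A E F" "uniformly_computable_in A E G"
  shows "uniformly_computable_in A E (\<lambda>e x. if P e x then F e x else G e x)"
proof -
  \<comment> \<open>Since truth is 0, a conditional is a recursion of zero rounds or one: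
    \<open>F\<close> is the starting value and a single round replaces it by
    \<open>G\<close>.\<close>
  have "uniformly_computable_in A E (\<lambda>e x. rec_nat (F e x) (\<lambda>m r. G e x) (if P e x then 0 else 1))"
    by (intro uc_rec uc_compose[OF assms(3)] uc_fst uc_id assms(1)[unfolded uniformly_decidable_in_def] assms(2))
  moreover have "rec_nat (F e x) (\<lambda>m r. G e x) (if P e x then 0 else 1) = (if P e x then F e x else G e x)" for e x
    by simp
  ultimately show ?thesis by simp
qed

section \<open>Boolean, arithmetical and bounded closure of decidable predicates\<close>

lemma ud_not: "uniformly_decidable_in A E P \<Longrightarrow> uniformly_decidable_in A E (\<lambda>e x. \<not> P e x)"
proof -
  assume "uniformly_decidable_in A E P"
  from uc_if[OF this uc_const[of A E 1] uc_const[of A E 0]]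
  have "uniformly_computable_in A E (\<lambda>e x. if P e x then 1 else 0)" .
  moreover have "(if b then 1 else 0) = (if \<not> b then 0 else 1::nat)" for b by simp
  ultimately show ?thesis by (simp only: uniformly_decidable_in_def)
qed

lemma ud_conj:
  assumes "uniformly_decidable_in A E P" "uniformly_decidable_in A E Q"
  shows "uniformly_decidable_in A E (\<lambda>e x. P e x \<and> Q e x)"
proof -
  have "uniformly_computable_in A E (\<lambda>e x. if P e x then if Q e x then 0 else 1 else 1)"
    by (intro uc_if assms uc_const)
  moreover have "(if P e x then if Q e x then 0 else 1 else 1) = (if P e x \<and> Q e x then 0 else 1::nat)" for e x
    by simp
  ultimately show ?thesis by (simp add: uniformly_decidable_in_def)
qed

lemma ud_disj:
  assumes "uniformly_decidable_in A E P" "uniformly_decidable_in A E Q"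
  shows "uniformly_decidable_in A E (\<lambda>e x. P e x \<or> Q e x)"
  using ud_not[OF ud_conj[OF ud_not ud_not, OF assms]] by simp

lemma ud_imp:
  assumes "uniformly_decidable_in A E P" "uniformly_decidable_in A E Q"
  shows "uniformly_decidable_in A E (\<lambda>e x. P e x \<longrightarrow> Q e x)"
  using ud_not[OF ud_conj[OF assms(1) ud_not[OF assms(2)]]] by simp

lemma ud_compose:
  assumes "uniformly_decidable_in A E P" "uniformly_computable_in A E F"
  shows "uniformly_decidable_in A E (\<lambda>e x. P e (F e x))"
  using uc_compose[OF assms[unfolded uniformly_decidable_in_def]]
  by (simp add: uniformly_decidable_in_def)

lemma uc_pred:
  assumes "uniformly_computable_in A E F" shows "uniformly_computable_in A E (\<lambda>e x. F e x - 1)"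
proof -
  have "uniformly_computable_in A E (\<lambda>e x. rec_nat 0 (\<lambda>m r. m) (F e x))"
    by (intro uc_rec uc_0 assms uc_fst uc_snd uc_id)
  moreover have "rec_nat 0 (\<lambda>m r. m) n = n - 1" for n by (cases n) auto
  ultimately show ?thesis by simp
qed

lemma uc_diff:
  assumes "uniformly_computable_in A E F" "uniformly_computable_in A E G"
  shows "uniformly_computable_in A E (\<lambda>e x. F e x - G e x)"
proof -
  have "uniformly_computable_in A E (\<lambda>e x. rec_nat (F e x) (\<lambda>m r. r - 1) (G e x))"
    by (intro uc_rec uc_pred assms uc_fst uc_snd uc_id)
  moreover have "rec_nat m (\<lambda>m r. r - 1) n = m - n" for m n :: nat
    by (induction n) auto
  ultimately show ?thesis by simp
qed

lemma uc_add:
  assumes "uniformly_computable_in A E F" "uniformly_computable_in A E G"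
  shows "uniformly_computable_in A E (\<lambda>e x. F e x + G e x)"
proof -
  have "uniformly_computable_in A E (\<lambda>e x. rec_nat (F e x) (\<lambda>m r. Suc r) (G e x))"
    by (intro uc_rec uc_Suc assms uc_fst uc_snd uc_id)
  moreover have "rec_nat m (\<lambda>m r. Suc r) n = m + n" for m n :: nat
    by (induction n) auto
  ultimately show ?thesis by simp
qed

lemma uc_code:
  assumes "uniformly_computable_in A E F" shows "uniformly_computable_in A E (\<lambda>e x. k + 4 * F e x)"
proof -
  have "uniformly_computable_in A E (\<lambda>e x. k + (F e x + F e x + (F e x + F e x)))"
    by (intro uc_add uc_const assms)
  then show ?thesis by (simp add: numeral_eq_Suc add.assoc)
qed

lemma ud_eq_0:
  assumes "uniformly_computable_in A E F" shows "uniformly_decidable_in A E (\<lambda>e x. F e x = 0)"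
proof -
  have "uniformly_computable_in A E (\<lambda>e x. rec_nat 0 (\<lambda>m r. 1) (F e x))"
    by (intro uc_rec uc_const assms)
  moreover have "rec_nat 0 (\<lambda>m r. 1) n = (if n = 0 then 0 else 1::nat)" for n by (cases n) auto
  ultimately show ?thesis by (simp add: uniformly_decidable_in_def)
qed

lemma ud_less:
  assumes "uniformly_computable_in A E F" "uniformly_computable_in A E G"
  shows "uniformly_decidable_in A E (\<lambda>e x. F e x < G e x)"
  using ud_not[OF ud_eq_0[OF uc_diff[OF assms(2,1)]]] by (simp add: not_le)

lemma ud_le:
  assumes "uniformly_computable_in A E F" "uniformly_computable_in A E G"
  shows "uniformly_decidable_in A E (\<lambda>e x. F e x \<le> G e x)"
  using ud_eq_0[OF uc_diff[OF assms]] by simp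

lemma ud_eq:
  assumes "uniformly_computable_in A E F" "uniformly_computable_in A E G"
  shows "uniformly_decidable_in A E (\<lambda>e x. F e x = G e x)"
  using ud_conj[OF ud_le ud_le, OF assms assms(2,1)] by (simp add: eq_iff)

lemma ud_all_less:
  assumes "uniformly_computable_in A E N"
    "uniformly_decidable_in A E (\<lambda>e z. P e (fst (prod_decode z)) (snd (prod_decode z)))"
  shows "uniformly_decidable_in A E (\<lambda>e x. \<forall>i<N e x. P e x i)"
proof -
  have "uniformly_decidable_in A E (\<lambda>e z. P e (fst (prod_decode z)) (fst (prod_decode (snd (prod_decode z)))))"
    using ud_compose[OF assms(2) uc_pair[OF uc_fst[OF uc_id] uc_fst[OF uc_snd[OF uc_id]]]] by simp
  \<comment> \<open>The value stays 0 until a false instance turns it into 1, and no later round can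
    restore 0.\<close>
  then have "uniformly_computable_in A E (\<lambda>e x. rec_nat 0 (\<lambda>m r. if P e x m then r else 1) (N e x))"
    by (intro uc_rec uc_if uc_const assms uc_snd uc_id)
  moreover have "rec_nat 0 (\<lambda>m r. if P e x m then r else 1) n = (if \<forall>i<n. P e x i then 0 else 1::nat)" for e x n
    by (induction n) (auto simp: less_Suc_eq)
  ultimately show ?thesis by (simp add: uniformly_decidable_in_def)
qed

lemma ud_ex_less:
  assumes "uniformly_computable_in A E N"
    "uniformly_decidable_in A E (\<lambda>e z. P e (fst (prod_decode z)) (snd (prod_decode z)))"
  shows "uniformly_decidable_in A E (\<lambda>e x. \<exists>i<N e x. P e x i)"
  using ud_not[OF ud_all_less[OF assms(1) ud_not[OF assms(2)]]] by simp

lemma uc_Least_ud: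
  assumes "uniformly_decidable_in A E (\<lambda>e z. P e (fst (prod_decode z)) (snd (prod_decode z)))"
    and "\<And>e x. e \<in> E \<Longrightarrow> \<exists>n. P e x n"
  shows "uniformly_computable_in A E (\<lambda>e x. LEAST n. P e x n)"
proof -
  have "(if b then 0 else 1::nat) = 0 \<longleftrightarrow> b" for b by simp
  then show ?thesis
    using uc_Least[of A E "\<lambda>e x n. if P e x n then 0 else 1"] assms
    unfolding uniformly_decidable_in_def by (simp only:)
qed

lemma ud_cong:
  assumes "uniformly_decidable_in A E P" "\<And>e x. e \<in> E \<Longrightarrow> P e x \<longleftrightarrow> Q e x"
  shows "uniformly_decidable_in A E Q"
  using assms unfolding uniformly_decidable_in_def uniformly_computable_in_def by auto

subsection \<open>Search, jump queries and coded lists\<close>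

text \<open>Both forms of computability of \<open>K\<close> serve: the built-in constant depends on
  the index in \<open>uc_parameter\<close> and on the input in \<open>ud_jump\<close>.\<close>

lemma constant_program:
  "\<exists>K. computable K \<and> (\<forall>A E. uniformly_computable_in A E (\<lambda>e. K)) \<and> (\<forall>A k x. Phi A (K k) x = Some k)"
proof -
  \<comment> \<open>As 0 codes \<open>Zero\<close>, 1 codes \<open>Succ\<close> and
    \<open>6 + 4 * ...\<close> forms a composition, \<open>K k\<close> codes \<open>k\<close>
    successors applied after \<open>Zero\<close>.\<close>
  define K where "K = rec_nat 0 (\<lambda>m r. 6 + 4 * prod_encode (1, r))"
  have uc: "uniformly_computable_in A E (\<lambda>e. K)" for A E
  proof -
    have "uniformly_computable_in A E (\<lambda>e x. rec_nat 0 (\<lambda>m r. 6 + 4 * prod_encode (1, r)) x)"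
      by (intro uc_rec uc_code uc_pair uc_const uc_snd uc_id)
    then show ?thesis by (simp add: K_def)
  qed
  have "computable K"
    using uc[of "{}" UNIV] unfolding uniformly_computable_in_def computable_def partial_computable_in_def
    by blast
  moreover have "Phi A (K k) x = Some k" for A k x
  proof (induction k)
    case 0
    show ?case using Phi_prog_code[of A Zero] by (simp add: K_def)
  next
    case (Suc k)
    have "inv prog_code 1 = Succ" using inv_prog_code[of Succ] by simp
    with Suc show ?case by (simp add: K_def Phi_Compose) (simp add: Phi_def)
  qed
  ultimately show ?thesis using uc by blast
qed

lemma uc_parameter:
  assumes "computable g" shows "uniformly_computable_in A E (\<lambda>e x. g e)"
proof -
  obtain K where "computable K" "\<And>A k x. Phi A (K k) x = Some k"
    using constant_program by blast
  then show ?thesis unfolding uniformly_computable_in_def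
    using computable_compose[OF _ assms] by (intro exI[of _ "\<lambda>e. K (g e)"]) simp
qed

text \<open>No universal program is called for: \<open>e\<close> is itself the code of the program
  that is composed with the one for \<open>G\<close>.\<close>

lemma uc_apply_index:
  assumes "uniformly_computable_in A E G"
    and "\<And>e x. e \<in> E \<Longrightarrow> Phi A e (G e x) = Some (F e x)"
  shows "uniformly_computable_in A E F"
proof -
  obtain t where "computable t" "\<forall>e\<in>E. \<forall>x. Phi A (t e) x = Some (G e x)"
    using assms(1) unfolding uniformly_computable_in_def by blast
  then show ?thesis unfolding uniformly_computable_in_def
    by (intro exI[of _ "\<lambda>e. 6 + 4 * prod_encode (e, t e)"] conjI computable_code computable_pair
        computable_id) (simp_all add: Phi_Compose assms(2) flip: Phi_def)
qed

text \<open>In contrast to \<open>uc_Least_ud\<close>, the search may have no hit; the function is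
  then undefined, as it must be past the end of a finite path.\<close>

lemma uc_partial_search:
  assumes "uniformly_decidable_in A E (\<lambda>e z. P e (fst (prod_decode z)) (snd (prod_decode z)))"
    and "uniformly_computable_in A E (\<lambda>e z. V e (fst (prod_decode z)) (snd (prod_decode z)))"
  shows "\<exists>t. computable t \<and> (\<forall>e\<in>E. \<forall>x. Phi A (t e) x =
      (if \<exists>n. P e x n then Some (V e x (LEAST n. P e x n)) else None))"
proof -
  obtain p where p: "computable p" "\<forall>e\<in>E. \<forall>z. Phi A (p e) z =
      Some (if P e (fst (prod_decode z)) (snd (prod_decode z)) then 0 else 1)"
    using assms(1) unfolding uniformly_decidable_in_def uniformly_computable_in_def by blast
  obtain v where v: "computable v" "\<forall>e\<in>E. \<forall>z. Phi A (v e) z =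
      Some (V e (fst (prod_decode z)) (snd (prod_decode z)))"
    using assms(2) unfolding uniformly_computable_in_def by blast
  have [simp]: "(if b then 0 else 1::nat) = 0 \<longleftrightarrow> b" for b by simp
  \<comment> \<open>This codes the program for \<open>V\<close> applied to the pair of the input,
    handed on by \<open>Tuple First Second\<close>, and the result of the search.\<close>
  define t where "t e = 6 + 4 * prod_encode (v e, 5 + 4 * prod_encode (prog_code (Tuple First Second), 8 + 4 * p e))" for e
  have "computable t" unfolding t_def
    by (intro computable_code computable_pair computable_const p(1) v(1))
  moreover have "Phi A (t e) x =
      (if \<exists>n. P e x n then Some (V e x (LEAST n. P e x n)) else None)" if "e \<in> E" for e x
  proof -
    have "Phi A (8 + 4 * p e) x = (if \<exists>n. P e x n then Some (LEAST n. P e x n) else None)"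
      using p(2) that unfolding Phi_Minimize by (simp add: minimize_Some flip: Phi_def)
    then show ?thesis
      using v(2) that unfolding t_def Phi_Compose
      by (simp del: prog_code.simps flip: Phi_def add: Phi_Tuple)
  qed
  ultimately show ?thesis by blast
qed

text \<open>The question is put to the oracle as the halting of a program that ignores its input
  and searches for \<open>n\<close>, with \<open>x\<close> built in as a constant.\<close>

lemma ud_jump:
  assumes "uniformly_decidable_in {} E (\<lambda>e z. P e (fst (prod_decode z)) (snd (prod_decode z)))"
  shows "uniformly_decidable_in (jump {}) E (\<lambda>e x. \<exists>n. P e x n)"
proof -
  obtain p where p: "computable p" "\<forall>e\<in>E. \<forall>z. phi (p e) z =
      Some (if P e (fst (prod_decode z)) (snd (prod_decode z)) then 0 else 1)"
    using assms unfolding uniformly_decidable_in_def uniformly_computable_in_def by blast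
  obtain K where K: "\<And>A E. uniformly_computable_in A E (\<lambda>e. K)" "\<And>A k x. Phi A (K k) x = Some k"
    using constant_program by blast
  define q where "q e x = 6 + 4 * prod_encode (8 + 4 * p e, K x)" for e x
  have [simp]: "(if b then 0 else 1::nat) = 0 \<longleftrightarrow> b" for b by simp
  have q: "uniformly_computable_in (jump {}) E q"
    unfolding q_def by (intro uc_code uc_pair uc_parameter computable_code p(1) K(1))
  have "phi (q e x) y = (if \<exists>n. P e x n then Some (LEAST n. P e x n) else None)" if "e \<in> E" for e x y
  proof -
    have "phi (8 + 4 * p e) x = (if \<exists>n. P e x n then Some (LEAST n. P e x n) else None)"
      using p(2) that unfolding Phi_Minimize by (simp add: minimize_Some flip: Phi_def)
    then show ?thesis
      unfolding q_def Phi_Compose by (simp flip: Phi_def add: K)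
  qed
  \<comment> \<open>The program halts on all inputs or on none, so the diagonal question whether it
    halts on its own code answers the search.\<close>
  then have jump: "q e x \<in> jump {} \<longleftrightarrow> (\<exists>n. P e x n)" if "e \<in> E" for e x
    using that by (simp add: jump_def)
  have "uniformly_computable_in (jump {}) E (\<lambda>e x. if x \<in> jump {} then 1 else 0)"
    by (rule uc_prog[of _ _ Query]) simp
  from ud_not[OF ud_eq_0[OF uc_compose[OF this q]]]
  show ?thesis by (rule ud_cong) (simp add: jump)
qed

text \<open>A decidable predicate is an existential one with a vacuous quantifier, so the jump query
  applies to it.\<close>

lemma ud_jump_lift:
  "uniformly_decidable_in {} E P \<Longrightarrow> uniformly_decidable_in (jump {}) E P"
  using ud_jump[of E "\<lambda>e x n. P e x", OF ud_compose[OF _ uc_fst[OF uc_id]]] by simp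

section \<open>Computing with coded lists\<close>

lemma prod_decode_0: "prod_decode 0 = (0, 0)"
  using prod_encode_inverse[of "(0, 0)"] by (simp add: prod_encode_def)

text \<open>A nonempty list is coded by the successor of a pair, which explains the subtraction. The
  code 0 of the empty list is a fixed point of the step, since
  \<open>prod_decode 0 = (0, 0)\<close>.\<close>

primrec code_drop :: "nat \<Rightarrow> nat \<Rightarrow> nat" where
  "code_drop 0 l = l"
| "code_drop (Suc n) l = snd (prod_decode (code_drop n l - 1))"

lemma list_decode_code_drop: "list_decode (code_drop n l) = drop n (list_decode l)"
proof (induction n)
  case (Suc n)
  have "list_decode (snd (prod_decode (m - 1))) = tl (list_decode m)" for m
    by (cases m) (simp_all add: prod_decode_0 case_prod_beta)
  with Suc show ?case by (simp add: drop_Suc tl_drop)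
qed simp

lemma list_decode_eq_Nil: "list_decode l = [] \<longleftrightarrow> l = 0"
  by (metis list_decode.simps(1) list_decode_eq)

lemma uc_code_drop:
  assumes "uniformly_computable_in A E F" "uniformly_computable_in A E G"
  shows "uniformly_computable_in A E (\<lambda>e x. code_drop (F e x) (G e x))"
proof -
  have "uniformly_computable_in A E (\<lambda>e x. rec_nat (G e x) (\<lambda>m r. snd (prod_decode (r - 1))) (F e x))"
    by (intro uc_rec assms uc_pred uc_snd uc_id)
  moreover have "rec_nat l (\<lambda>m r. snd (prod_decode (r - 1))) n = code_drop n l" for n l
    by (induction n) simp_all
  ultimately show ?thesis by simp
qed

lemma uc_length:
  assumes "uniformly_computable_in A E F"
  shows "uniformly_computable_in A E (\<lambda>e x. length (list_decode (F e x)))"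
proof -
  have *: "code_drop n l = 0 \<longleftrightarrow> length (list_decode l) \<le> n" for n l
    by (metis drop_eq_Nil list_decode_code_drop list_decode_eq_Nil)
  have "uniformly_computable_in A E (\<lambda>e x. LEAST n. code_drop n x = 0)"
    by (intro uc_Least uc_code_drop uc_fst uc_snd uc_id) (auto simp: *)
  moreover have "(LEAST n. code_drop n l = 0) = length (list_decode l)" for l
    unfolding * by (intro Least_equality) auto
  ultimately show ?thesis using uc_compose[OF _ assms] by simp
qed

text \<open>Unlike \<^const>\<open>nth\<close>, this has the computable value 0 beyond the end of the list.\<close>

definition entry :: "nat list \<Rightarrow> nat \<Rightarrow> nat" where
  "entry xs i = (if i < length xs then xs ! i else 0)"

lemma uc_entry:
  assumes "uniformly_computable_in A E F" "uniformly_computable_in A E G"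
  shows "uniformly_computable_in A E (\<lambda>e x. entry (list_decode (F e x)) (G e x))"
proof -
  have "fst (prod_decode (code_drop i l - 1)) = entry (list_decode l) i" for i l
  proof (cases "code_drop i l")
    case 0
    then have "length (list_decode l) \<le> i"
      by (metis drop_eq_Nil list_decode_code_drop list_decode_eq_Nil)
    with 0 show ?thesis by (simp add: entry_def prod_decode_0)
  next
    case (Suc m)
    then have "drop i (list_decode l) = fst (prod_decode m) # list_decode (snd (prod_decode m))"
      using list_decode_code_drop[of i l] by (simp add: case_prod_beta)
    with Suc show ?thesis
      by (metis diff_Suc_1 drop_eq_Nil entry_def hd_drop_conv_nth leI list.discI list.sel(1))
  qed
  moreover have "uniformly_computable_in A E (\<lambda>e x. fst (prod_decode (code_drop (G e x) (F e x) - 1)))"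
    by (intro uc_fst uc_pred uc_code_drop assms)
  ultimately show ?thesis by simp
qed

subsection \<open>Stable vertices and finite paths\<close>

definition monochromatic :: "coloring \<Rightarrow> color \<Rightarrow> nat list \<Rightarrow> bool" where
  "monochromatic c k xs \<longleftrightarrow> distinct xs \<and> successively (\<lambda>x y. c {x, y} = k) xs"

lemma monochromatic_Nil [simp]: "monochromatic c k []"
  and monochromatic_single [simp]: "monochromatic c k [x]"
  by (auto simp: monochromatic_def)

lemma monochromatic_snoc:
  "monochromatic c k (xs @ [y]) \<longleftrightarrow>
     monochromatic c k xs \<and> y \<notin> set xs \<and> (xs = [] \<or> c {last xs, y} = k)"
  by (auto simp: monochromatic_def successively_append_iff)

lemma INFM_avoiding:
  assumes "INFM x. P x" "finite F" obtains x where "P x" "x \<notin> F"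
proof -
  have "infinite ({x. P x} - F)" using assms by (simp add: INFM_iff_infinite)
  then show thesis using that infinite_imp_nonempty by blast
qed

text \<open>Among infinitely many common neighbors one avoids any finite set; \<open>F\<close> makes
  room for the vertices of the other path.\<close>

lemma link:
  assumes "monochromatic c k xs" "INFM x. c {last xs, x} = k \<and> c {v, x} = k"
    "v \<notin> set xs" "finite F"
  obtains w where "w \<notin> F" "monochromatic c k (xs @ [w, v])"
proof -
  obtain w where "c {last xs, w} = k" "c {v, w} = k" "w \<notin> F \<union> set xs \<union> {v}"
    using INFM_avoiding[OF assms(2), of "F \<union> set xs \<union> {v}"] assms(4) by auto
  then show thesis
    using assms monochromatic_snoc[of c k "xs @ [w]" v] monochromatic_snoc[of c k xs w]
    by (intro that[of w]) (auto simp: insert_commute)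
qed

abbreviation stable :: "coloring \<Rightarrow> color \<Rightarrow> nat \<Rightarrow> bool" where
  "stable c k v \<equiv> MOST x. c {v, x} = k"

text \<open>Two vertices stable in the same color share almost all vertices as neighbors in it, so
  the path can be led to the elements of \<open>S\<close> one by one. The clause on the last vertex
  is what the induction needs to continue.\<close>

lemma cover_stable:
  assumes "finite S" "\<And>v. v \<in> S \<Longrightarrow> stable c k v"
  shows "\<exists>xs. monochromatic c k xs \<and> S \<subseteq> set xs \<and> (xs = [] \<or> stable c k (last xs))"
  using assms
proof (induction S rule: finite_induct)
  case empty
  show ?case by (rule exI[of _ "[]"]) simp
next
  case (insert v S)
  then obtain xs where xs: "monochromatic c k xs" "S \<subseteq> set xs" "xs = [] \<or> stable c k (last xs)"
    by auto
  consider "v \<in> set xs" | "xs = []" | "v \<notin> set xs" "stable c k (last xs)" using xs(3) by blast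
  then show ?case
  proof cases
    case 1
    then show ?thesis using xs by blast
  next
    case 2
    then show ?thesis using xs insert.prems by (intro exI[of _ "[v]"]) auto
  next
    case 3
    have "MOST x. c {last xs, x} = k \<and> c {v, x} = k"
      using 3(2) insert.prems[of v] by (simp add: MOST_conj_distrib)
    then obtain w where "monochromatic c k (xs @ [w, v])"
      using link[OF xs(1) MOST_INFM[OF infinite_UNIV_nat] 3(1) finite.emptyI] by blast
    then show ?thesis using xs insert.prems by (intro exI[of _ "xs @ [w, v]"]) auto
  qed
qed

text \<open>A cofinite and an infinite set of neighbors meet in an infinite set. This is used twice:
  the old end is stable while \<open>v\<close> has infinitely many neighbors, and then
  \<open>v\<close> is joined in the same way to a fresh stable vertex, the new end.\<close>

lemma extend_stable:
  assumes xs: "monochromatic c k xs" "xs = [] \<or> stable c k (last xs)"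
    and v: "INFM x. c {v, x} = k" "v \<notin> set xs" "v \<notin> F"
    and F: "finite F" and S: "infinite {s. stable c k s}"
  obtains ys where "monochromatic c k (xs @ ys)" "v \<in> set ys" "set ys \<inter> F = {}"
    "stable c k (last (xs @ ys))"
proof -
  obtain zs where zs: "monochromatic c k (xs @ zs @ [v])" "set zs \<inter> F = {}"
  proof (cases "xs = []")
    case True
    then show thesis using that[of "[]"] by simp
  next
    case False
    then have "INFM x. c {v, x} = k \<and> c {last xs, x} = k"
      using xs(2) v(1) by (intro INFM_conjI) auto
    then show thesis
      using link[OF xs(1) _ v(2) F] that[of "[_]"] by (auto simp: conj_commute)
  qed
  let ?us = "xs @ zs @ [v]"
  have "INFM s. stable c k s" using S by (simp add: INFM_iff_infinite)
  then obtain s where s: "stable c k s" "s \<notin> F \<union> set ?us"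
    using INFM_avoiding[of "stable c k" "F \<union> set ?us"] F by auto
  have "INFM x. c {last ?us, x} = k \<and> c {s, x} = k"
    using INFM_conjI[OF v(1) s(1)] by simp
  then obtain w where "w \<notin> F" "monochromatic c k (?us @ [w, s])"
    using link[OF zs(1) _ _ F] s(2) by blast
  then show thesis using that[of "zs @ [v, w, s]"] zs(2) v(3) s by auto
qed

definition spanning :: "coloring \<Rightarrow> color \<Rightarrow> nat set \<Rightarrow> bool" where
  "spanning c k F \<longleftrightarrow> (\<forall>P v. monochromatic c k P \<longrightarrow> set P \<inter> F = {} \<longrightarrow> v \<notin> F \<longrightarrow>
     (\<exists>ys. monochromatic c k (P @ ys) \<and> set ys \<inter> F = {} \<and> v \<in> set (P @ ys)))"

fun opposite :: "color \<Rightarrow> color" where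
  "opposite BLUE = RED" | "opposite RED = BLUE"

lemma neq_iff_opposite: "a \<noteq> k \<longleftrightarrow> a = opposite k"
  by (cases a; cases k) auto

lemma not_stable: "\<not> stable c k v \<Longrightarrow> INFM x. c {v, x} = opposite k"
  by (simp add: neq_iff_opposite)

text \<open>The bipartite graph serves as a hub: the end of \<open>P\<close> and \<open>v\<close>
  both have fresh neighbors in it, and two distinct vertices of it are joined by an edge or through
  one fresh vertex.\<close>

lemma spanning_complete_bipartite:
  assumes inf: "infinite D" "infinite W" and cofin: "finite (- (D \<union> W))"
    and DW: "\<And>x y. x \<in> D \<Longrightarrow> y \<in> W \<Longrightarrow> c {x, y} = k"
    and Q: "finite F" "\<And>v. v \<notin> F \<Longrightarrow> INFM x. c {v, x} = k"
  shows "spanning c k F"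
  unfolding spanning_def
proof (intro allI impI)
  fix P v assume P: "monochromatic c k P" "set P \<inter> F = {}" and v: "v \<notin> F"
  consider "v \<in> set P" | "P = []" | "v \<notin> set P" "P \<noteq> []" by blast
  then show "\<exists>ys. monochromatic c k (P @ ys) \<and> set ys \<inter> F = {} \<and> v \<in> set (P @ ys)"
  proof cases
    case 1
    then show ?thesis using P by (intro exI[of _ "[]"]) auto
  next
    case 2
    then show ?thesis using v by (intro exI[of _ "[v]"]) auto
  next
    case 3
    \<comment> \<open>Including the finite set \<open>- (D \<union> W)\<close> forces the neighbors
      \<open>a\<close> and \<open>b\<close>, chosen outside \<open>G\<close>, into the bipartite
      graph.\<close>
    define G where "G = F \<union> set P \<union> {v} \<union> - (D \<union> W)"
    have G: "finite G" using Q(1) cofin by (simp add: G_def)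
    have "last P \<notin> F" using 3 P(2) last_in_set by blast
    then obtain a where a: "c {last P, a} = k" "a \<notin> G" by (rule INFM_avoiding[OF Q(2) G])
    have "finite (insert a G)" using G by simp
    then obtain b where b: "c {v, b} = k" "b \<notin> insert a G" by (rule INFM_avoiding[OF Q(2)[OF v]])
    have "\<exists>x. x \<in> X \<and> x \<notin> G \<union> {a, b}" if "infinite X" for X
    proof -
      have "infinite (X - (G \<union> {a, b}))" using Diff_infinite_finite[OF _ that] G by simp
      then have "X - (G \<union> {a, b}) \<noteq> {}" by (rule infinite_imp_nonempty)
      then show ?thesis by blast
    qed
    then obtain d w where d: "d \<in> D" "d \<notin> G \<union> {a, b}" and w: "w \<in> W" "w \<notin> G \<union> {a, b}"
      using inf by meson
    have DW': "c {y, x} = k" if "x \<in> D" "y \<in> W" for x y using DW[OF that] by (simp add: insert_commute)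
    have ab: "a \<in> D \<union> W" "b \<in> D \<union> W" using a(2) b(2) by (auto simp: G_def)
    \<comment> \<open>Here \<open>zs\<close> is the connection from \<open>a\<close> to
      \<open>b\<close>: empty if they lie on different sides, else one vertex of the other
      side.\<close>
    have step: "?thesis" if "successively (\<lambda>x y. c {x, y} = k) (a # zs @ [b])"
      "distinct (a # zs @ [b])" "set zs \<inter> G = {}" for zs
      using that P a b v 3
      by (intro exI[of _ "a # zs @ [b, v]"])
         (auto simp: monochromatic_def successively_append_iff successively_Cons hd_append G_def insert_commute split: if_splits)
    from ab consider "a \<in> D" "b \<in> D" | "a \<in> D" "b \<in> W" | "a \<in> W" "b \<in> D" | "a \<in> W" "b \<in> W" by blast
    then show ?thesis
    proof cases
      case 1 then show ?thesis using w b DW DW' by (intro step[of "[w]"]) auto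
    next
      case 2 then show ?thesis using b DW DW' by (intro step[of "[]"]) auto
    next
      case 3 then show ?thesis using b DW DW' by (intro step[of "[]"]) auto
    next
      case 4 then show ?thesis using d b DW DW' by (intro step[of "[d]"]) auto
    qed
  qed
qed

text \<open>If covering \<open>v\<close> fails from the end of \<open>P\<close>, the vertices \<open>D\<close> reachable from that end and the
  others, \<open>W\<close>, are joined completely in the color \<open>k\<close>. Both are infinite, as the end of \<open>P\<close>
  and \<open>v\<close> have infinitely many neighbors of the color of \<open>P\<close>; so the colors exchange roles.\<close>

lemma finite_stable_imp_spanning:
  assumes "finite {v. stable c k v}"
  shows "\<exists>k Q. monochromatic c k Q \<and> spanning c (opposite k) (set Q)"
proof -
  obtain Q where Q: "monochromatic c k Q" "{v. stable c k v} \<subseteq> set Q"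
    using cover_stable[OF assms, of c k] by auto
  show ?thesis
  proof (cases "spanning c (opposite k) (set Q)")
    case True
    then show ?thesis using Q by blast
  next
    case False
    let ?l = "opposite k"
    obtain P v where P: "monochromatic c ?l P" "set P \<inter> set Q = {}" and v: "v \<notin> set Q"
      and blocked: "\<And>ys. monochromatic c ?l (P @ ys) \<Longrightarrow> set ys \<inter> set Q = {} \<Longrightarrow> v \<notin> set (P @ ys)"
      using False unfolding spanning_def by blast
    have "P \<noteq> []" using blocked[of "[v]"] v by auto
    have "v \<notin> set P" using blocked[of "[]"] P by auto
    have Qinf: "INFM x. c {u, x} = ?l" if "u \<notin> set Q" for u
      using Q(2) that not_stable by blast
    define U where "U = - (set P \<union> set Q)"
    define D where "D = {x. \<exists>ys. monochromatic c ?l (P @ ys @ [x]) \<and> set (ys @ [x]) \<subseteq> U}"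
    define W where "W = U - D"
    have U: "- (D \<union> W) = set P \<union> set Q" by (auto simp: U_def W_def D_def)
    have vW: "v \<in> W"
      using blocked v \<open>v \<notin> set P\<close> by (fastforce simp: W_def U_def D_def)
    have DW: "c {x, y} = k" if "x \<in> D" "y \<in> W" for x y
    proof (rule ccontr)
      assume "c {x, y} \<noteq> k"
      then have xy: "c {x, y} = ?l" by (simp add: neq_iff_opposite)
      obtain ys where ys: "monochromatic c ?l (P @ ys @ [x])" "set (ys @ [x]) \<subseteq> U"
        using \<open>x \<in> D\<close> by (auto simp: D_def)
      \<comment> \<open>An edge of color \<open>?l\<close> would make \<open>y\<close> reachable:
        append it to the path that reaches \<open>x\<close>, or, if it already lies there, cut the
        path off at \<open>y\<close>.\<close>
      have "y \<in> D"
      proof (cases "y \<in> set (ys @ [x])")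
        case True
        then obtain as bs where "ys @ [x] = as @ y # bs" by (meson split_list)
        then have "P @ ys @ [x] = (P @ as @ [y]) @ bs" "set (as @ [y]) \<subseteq> U" using ys(2) by auto
        then have "monochromatic c ?l (P @ as @ [y])"
          using ys(1) unfolding monochromatic_def by (metis distinct_append successively_append_iff)
        then show ?thesis using \<open>set (as @ [y]) \<subseteq> U\<close> by (auto simp: D_def)
      next
        case False
        have "y \<in> U" using \<open>y \<in> W\<close> by (simp add: W_def)
        with False have "monochromatic c ?l (P @ (ys @ [x]) @ [y])"
          using ys(1) xy monochromatic_snoc[of c ?l "P @ ys @ [x]" y] by (auto simp: U_def)
        then show ?thesis using ys(2) \<open>y \<in> U\<close> by (auto simp: D_def intro!: exI[of _ "ys @ [x]"])
      qed
      then show False using \<open>y \<in> W\<close> by (simp add: W_def)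
    qed
    have "infinite {x. c {v, x} = ?l}"
      using Qinf[OF v] by (simp add: INFM_iff_infinite)
    moreover have "{x. c {v, x} = ?l} \<subseteq> W \<union> set P \<union> set Q"
      using DW[OF _ vW] U neq_iff_opposite by (fastforce simp: insert_commute)
    ultimately have W: "infinite W" using finite_subset by auto
    have "last P \<notin> set Q" using \<open>P \<noteq> []\<close> P(2) last_in_set by blast
    then have "infinite {x. c {last P, x} = ?l}"
      using Qinf by (simp add: INFM_iff_infinite)
    moreover have "x \<in> D" if "c {last P, x} = ?l" "x \<in> U" for x
      using that P(1) monochromatic_snoc[of c ?l P x]
      by (auto simp: D_def U_def intro!: exI[of _ "[]"])
    then have "{x. c {last P, x} = ?l} \<subseteq> D \<union> set P \<union> set Q" by (auto simp: U_def)
    ultimately have D: "infinite D" using finite_subset by auto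
    \<comment> \<open>A vertex on one side is joined in color \<open>k\<close> to the whole other
      side, which is infinite; so it cannot be stable in \<open>?l\<close>.\<close>
    have "v \<notin> D \<union> W" if "stable c ?l v" for v
    proof -
      have "finite {x. c {v, x} = k}"
        using that by (simp add: eventually_cofinite neq_iff_opposite[symmetric])
      moreover have "W \<subseteq> {x. c {v, x} = k}" if "v \<in> D" using DW[OF that] by blast
      moreover have "D \<subseteq> {x. c {v, x} = k}" if "v \<in> W" using DW[OF _ that] by (auto simp: insert_commute)
      ultimately show ?thesis using D W finite_subset by blast
    qed
    then have "{v. stable c ?l v} \<subseteq> set P \<union> set Q" using U by blast
    then have "finite {v. stable c ?l v}" by (rule finite_subset) simp
    from cover_stable[OF this, of c ?l]
    obtain R where R: "monochromatic c ?l R" "{v. stable c ?l v} \<subseteq> set R" by auto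
    have k: "opposite ?l = k" by (cases k) auto
    \<comment> \<open>A vertex outside \<open>R\<close> is not stable in \<open>?l\<close>. This is
      the degree condition for using \<open>D\<close> and \<open>W\<close> as the hub of color
      \<open>k\<close>.\<close>
    have "INFM x. c {u, x} = k" if "u \<notin> set R" for u
      using R(2) that not_stable[of c u ?l] unfolding k by blast
    then have "spanning c k (set R)"
      using D W U DW by (intro spanning_complete_bipartite[of D W]) auto
    then show ?thesis using R(1) k by metis
  qed
qed

subsection \<open>Decompositions as limits of searches\<close>

text \<open>The least stage is taken because this is what a search program finds; along a chain of
  prefixes every stage that is long enough gives the same value.\<close>

definition list_limit :: "(nat \<Rightarrow> nat list) \<Rightarrow> nat \<Rightarrow> nat option" where
  "list_limit L n = (if \<exists>m. n < length (L m) then Some (L (LEAST m. n < length (L m)) ! n) else None)"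

context
  fixes L :: "nat \<Rightarrow> nat list"
  assumes chain: "\<And>m. prefix (L m) (L (Suc m))"
begin

lemma prefix_chain: "m \<le> n \<Longrightarrow> prefix (L m) (L n)"
proof (induction rule: dec_induct)
  case (step n)
  then show ?case using chain prefix_order.trans by blast
qed simp

lemma list_limit_nth:
  assumes "n < length (L m)" shows "list_limit L n = Some (L m ! n)"
proof -
  let ?j = "LEAST m. n < length (L m)"
  have j: "n < length (L ?j)" using assms by (rule LeastI)
  have "?j \<le> m" using assms by (rule Least_le)
  then have "L m ! n = L ?j ! n" using prefix_chain j by (metis nth_append prefix_def)
  then show ?thesis using assms by (auto simp: list_limit_def)
qed

lemma dom_list_limit: "n \<in> dom (list_limit L) \<longleftrightarrow> (\<exists>m. n < length (L m))"
  by (auto simp: list_limit_def dom_def)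

lemma ran_list_limit: "ran (list_limit L) = (\<Union>m. set (L m))"
proof (intro equalityI subsetI)
  fix y assume "y \<in> ran (list_limit L)"
  then obtain n where n: "list_limit L n = Some y" by (auto simp: ran_def)
  then obtain m where "n < length (L m)" using dom_list_limit by blast
  then show "y \<in> (\<Union>m. set (L m))" using n list_limit_nth[of n m] nth_mem by fastforce
next
  fix y assume "y \<in> (\<Union>m. set (L m))"
  then show "y \<in> ran (list_limit L)" using list_limit_nth by (fastforce simp: in_set_conv_nth ran_def)
qed

lemma path_list_limit:
  assumes "\<And>m. monochromatic c k (L m)" shows "path c k (list_limit L)"
  unfolding path_def
proof (intro conjI allI impI)
  show "initial_segment (dom (list_limit L))"
    unfolding initial_segment_def
  proof (intro ballI allI impI)
    fix n m assume "n \<in> dom (list_limit L)" "m < n"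
    then show "m \<in> dom (list_limit L)" unfolding dom_list_limit by (meson less_trans)
  qed
  show "inj_on (list_limit L) (dom (list_limit L))"
  proof (rule inj_onI)
    fix i j assume "i \<in> dom (list_limit L)" "j \<in> dom (list_limit L)"
      and eq: "list_limit L i = list_limit L j"
    then obtain m m' where "i < length (L m)" "j < length (L m')" by (auto simp: dom_list_limit)
    then have "i < length (L (max m m'))" "j < length (L (max m m'))"
      using prefix_chain[of m "max m m'"] prefix_chain[of m' "max m m'"]
      by (meson less_le_trans max.cobounded1 max.cobounded2 prefix_length_le)+
    then show "i = j"
      using eq list_limit_nth assms[of "max m m'"] unfolding monochromatic_def
      by (metis nth_eq_iff_index_eq option.inject)
  qed
next
  fix n assume "Suc n \<in> dom (list_limit L)"
  then obtain m where m: "Suc n < length (L m)" by (auto simp: dom_list_limit)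
  then show "c {the (list_limit L n), the (list_limit L (Suc n))} = k"
    using list_limit_nth[of n m] list_limit_nth[of "Suc n" m] assms[of m]
      successively_nth[of "\<lambda>x y. c {x, y} = k" "L m" n]
    by (simp add: monochromatic_def)
qed

end

text \<open>A search state codes a finite path of each color and an auxiliary number, which will
  bound the exceptions to the stability of the two ends.\<close>

fun part_code :: "color \<Rightarrow> nat \<Rightarrow> nat" where
  "part_code BLUE w = fst (prod_decode w)"
| "part_code RED w = fst (prod_decode (snd (prod_decode w)))"

definition part :: "color \<Rightarrow> nat \<Rightarrow> nat list" where
  "part k w = list_decode (part_code k w)"

definition state :: "(color \<Rightarrow> nat list) \<Rightarrow> nat \<Rightarrow> nat" where
  "state L n = prod_encode (list_encode (L BLUE), prod_encode (list_encode (L RED), n))"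

lemma part_state [simp]: "part k (state L n) = L k"
  by (cases k) (simp_all add: part_def state_def)

section \<open>Conditions on states, and limits of sequences of states\<close>

definition valid :: "coloring \<Rightarrow> nat \<Rightarrow> bool" where
  "valid c w \<longleftrightarrow> (\<forall>k. monochromatic c k (part k w)) \<and> set (part BLUE w) \<inter> set (part RED w) = {}"

definition extends :: "nat \<Rightarrow> nat \<Rightarrow> bool" where
  "extends w w' \<longleftrightarrow> (\<forall>k. prefix (part k w) (part k w'))"

definition covers :: "nat \<Rightarrow> nat \<Rightarrow> bool" where
  "covers w m \<longleftrightarrow> m \<in> set (part BLUE w) \<union> set (part RED w)"

lemma all_color: "(\<forall>k. P k) \<longleftrightarrow> P BLUE \<and> P RED"
  by (metis color.exhaust)

text \<open>The range of each limit is the union of its stages. An element of both ranges would lie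
  on both paths at a common later stage.\<close>

lemma path_decomposition_limit:
  assumes "\<And>m. valid c (w m)" "\<And>m. extends (w m) (w (Suc m))" "\<And>m. covers (w (Suc m)) m"
  shows "path_decomposition c (list_limit (\<lambda>m. part BLUE (w m))) (list_limit (\<lambda>m. part RED (w m)))"
proof -
  have chain: "prefix (part k (w m)) (part k (w (Suc m)))" for k m
    using assms(2) by (simp add: extends_def)
  have mono: "prefix (part k (w m)) (part k (w n))" if "m \<le> n" for k m n
    using prefix_chain[of "\<lambda>m. part k (w m)", OF chain that] .
  have "path c k (list_limit (\<lambda>m. part k (w m)))" for k
    using path_list_limit[of "\<lambda>m. part k (w m)", OF chain] assms(1) by (simp add: valid_def)
  moreover have "(\<Union>m. set (part BLUE (w m))) \<union> (\<Union>m. set (part RED (w m))) = UNIV"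
    using assms(3) by (auto simp: covers_def)
  moreover have "set (part BLUE (w m)) \<inter> set (part RED (w n)) = {}" for m n
    using mono[of m "max m n" BLUE] mono[of n "max m n" RED] assms(1)[of "max m n"]
    by (fastforce simp: valid_def dest: set_mono_prefix)
  ultimately show ?thesis
    unfolding path_decomposition_def ran_list_limit[of "\<lambda>m. part BLUE (w m)", OF chain]
      ran_list_limit[of "\<lambda>m. part RED (w m)", OF chain] by blast
qed

section \<open>Decidability of the conditions on states\<close>

lemma uc_part_code:
  assumes "uniformly_computable_in A E F"
  shows "uniformly_computable_in A E (\<lambda>e x. part_code k (F e x))"
  by (cases k) (simp_all add: uc_fst uc_snd assms)

text \<open>Bounded quantifiers and the total function \<open>entry\<close> make this decidable. The
  inequality of consecutive entries stands next to the color to match the form of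
  \<open>ud_edge\<close>.\<close>

lemma monochromatic_entry:
  "monochromatic c k xs \<longleftrightarrow> (\<forall>i<length xs. \<forall>j<i. entry xs i \<noteq> entry xs j) \<and>
     (\<forall>i<length xs - 1. entry xs i \<noteq> entry xs (Suc i) \<and> c {entry xs i, entry xs (Suc i)} = k)"
proof -
  have "distinct xs \<longleftrightarrow> (\<forall>i<length xs. \<forall>j<i. xs ! i \<noteq> xs ! j)"
    unfolding distinct_conv_nth by (metis less_trans linorder_neqE_nat less_irrefl)
  also have "\<dots> \<longleftrightarrow> (\<forall>i<length xs. \<forall>j<i. entry xs i \<noteq> entry xs j)"
    by (simp add: entry_def)
  finally show ?thesis
    by (auto simp: monochromatic_def successively_conv_nth entry_def nth_eq_iff_index_eq)
qed

lemma prefix_entry: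
  "prefix xs ys \<longleftrightarrow> length xs \<le> length ys \<and> (\<forall>i<length xs. entry xs i = entry ys i)"
proof
  assume "length xs \<le> length ys \<and> (\<forall>i<length xs. entry xs i = entry ys i)"
  then have "xs = take (length xs) ys" by (auto simp: entry_def intro: nth_equalityI)
  then show "prefix xs ys" by (metis take_is_prefix)
qed (auto simp: entry_def prefix_def nth_append)

lemma disjoint_entry:
  "set xs \<inter> set ys = {} \<longleftrightarrow> (\<forall>i<length xs. \<forall>j<length ys. entry xs i \<noteq> entry ys j)"
  by (fastforce simp: entry_def in_set_conv_nth disjoint_iff)

lemma in_set_entry: "m \<in> set xs \<longleftrightarrow> (\<exists>i<length xs. entry xs i = m)"
  by (auto simp: entry_def in_set_conv_nth)

text \<open>A program for the coloring promises nothing on one-element sets, so a question about a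
  color is joined with the distinctness of the vertices.\<close>

locale coloring_family =
  fixes A :: "nat set" and E :: "nat set" and C :: "nat \<Rightarrow> coloring"
  assumes ud_edge: "\<And>k. uniformly_decidable_in A E
    (\<lambda>e z. fst (prod_decode z) \<noteq> snd (prod_decode z) \<and> C e {fst (prod_decode z), snd (prod_decode z)} = k)"
begin

lemma ud_edge':
  assumes "uniformly_computable_in A E F" "uniformly_computable_in A E G"
  shows "uniformly_decidable_in A E (\<lambda>e x. F e x \<noteq> G e x \<and> C e {F e x, G e x} = k)"
  using ud_compose[OF ud_edge uc_pair[OF assms]] by simp

lemma ud_valid:
  assumes "uniformly_computable_in A E F"
  shows "uniformly_decidable_in A E (\<lambda>e x. valid (C e) (F e x))"
  unfolding valid_def all_color monochromatic_entry disjoint_entry part_def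
  by (intro ud_conj ud_all_less uc_length uc_pred ud_not ud_eq uc_entry ud_edge' uc_part_code uc_Suc uc_fst
      uc_snd uc_id uc_compose[OF assms])

lemma ud_extends:
  assumes "uniformly_computable_in A E F" "uniformly_computable_in A E G"
  shows "uniformly_decidable_in A E (\<lambda>e x. extends (F e x) (G e x))"
  unfolding extends_def all_color prefix_entry part_def
  by (intro ud_conj ud_all_less ud_le uc_length ud_eq uc_entry uc_part_code uc_fst
      uc_snd uc_id uc_compose[OF assms(1)] uc_compose[OF assms(2)])

lemma ud_covers:
  assumes "uniformly_computable_in A E F" "uniformly_computable_in A E G"
  shows "uniformly_decidable_in A E (\<lambda>e x. covers (F e x) (G e x))"
  unfolding covers_def Un_iff in_set_entry part_def
  by (intro ud_disj ud_ex_less uc_length ud_eq uc_entry uc_part_code uc_fst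
      uc_snd uc_id uc_compose[OF assms(1)] uc_compose[OF assms(2)])

text \<open>The last conclusion makes one of the paths finite if \<open>H\<close> freezes it.\<close>

lemma decomposition_by_search:
  assumes H: "uniformly_decidable_in A E H"
    and start: "\<And>e. e \<in> E \<Longrightarrow> \<exists>w. valid (C e) w \<and> H e w"
    and extend: "\<And>e w m. e \<in> E \<Longrightarrow> valid (C e) w \<Longrightarrow> H e w \<Longrightarrow>
      \<exists>w'. valid (C e) w' \<and> H e w' \<and> extends w w' \<and> covers w' m"
  shows "\<exists>t. (\<forall>k. computable (t k)) \<and> (\<forall>e\<in>E.
      path_decomposition (C e) (Phi A (t BLUE e)) (Phi A (t RED e)) \<and>
      (\<forall>k. \<forall>n\<in>dom (Phi A (t k e)). \<exists>w. H e w \<and> n < length (part k w)))"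
proof -
  \<comment> \<open>The implication makes the inner search total, as \<open>uc_Least_ud\<close>
    demands: from a state that is not good, any number will do.\<close>
  define W where "W e = rec_nat (LEAST w. valid (C e) w \<and> H e w)
      (\<lambda>m w. LEAST w'. valid (C e) w \<and> H e w \<longrightarrow> valid (C e) w' \<and> H e w' \<and> extends w w' \<and> covers w' m)" for e
  have good: "valid (C e) (W e m) \<and> H e (W e m)"
    and step: "extends (W e m) (W e (Suc m))" "covers (W e (Suc m)) m" if e: "e \<in> E" for e m
  proof -
    have 0: "valid (C e) (W e 0) \<and> H e (W e 0)"
      using LeastI_ex[OF start[OF e]] by (simp add: W_def)
    have Suc: "valid (C e) (W e (Suc m)) \<and> H e (W e (Suc m)) \<and> extends (W e m) (W e (Suc m)) \<and>
        covers (W e (Suc m)) m" if "valid (C e) (W e m) \<and> H e (W e m)" for m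
      using LeastI_ex[OF extend[OF e, of "W e m" m]] that by (simp add: W_def)
    show *: "valid (C e) (W e m) \<and> H e (W e m)" for m
      by (induction m) (use 0 Suc in blast)+
    show "extends (W e m) (W e (Suc m))" "covers (W e (Suc m)) m"
      using Suc[OF *] by auto
  qed
  have ex: "\<exists>w'. valid (C e) w \<and> H e w \<longrightarrow> valid (C e) w' \<and> H e w' \<and> extends w w' \<and> covers w' m"
    if "e \<in> E" for e w m
    using extend[OF that] by blast
  have "uniformly_computable_in A E (\<lambda>e x. W e x)"
    unfolding W_def using start ex
    by (intro uc_rec uc_Least_ud ud_imp ud_conj ud_valid ud_extends ud_covers ud_compose[OF H]
        uc_fst uc_snd uc_id) blast+
  note uc_W = uc_compose[OF this]
  have "\<exists>t. computable t \<and> (\<forall>e\<in>E. \<forall>n. Phi A (t e) n =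
      (if \<exists>m. n < length (part k (W e m))
       then Some (entry (part k (W e (LEAST m. n < length (part k (W e m))))) n) else None))" for k
    unfolding part_def
    by (rule uc_partial_search[of A E "\<lambda>e n m. n < length (list_decode (part_code k (W e m)))"
          "\<lambda>e n m. entry (list_decode (part_code k (W e m))) n"])
      (intro ud_less uc_length uc_entry uc_part_code uc_W uc_fst uc_snd uc_id)+
  then obtain t where t: "\<And>k. computable (t k)" "\<And>k e n. e \<in> E \<Longrightarrow> Phi A (t k e) n =
      (if \<exists>m. n < length (part k (W e m))
       then Some (entry (part k (W e (LEAST m. n < length (part k (W e m))))) n) else None)"
    by metis
  have lim: "Phi A (t k e) = list_limit (\<lambda>m. part k (W e m))" if "e \<in> E" for k e
  proof
    fix n
    have "n < length (part k (W e (LEAST m. n < length (part k (W e m)))))"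
      if "\<exists>m. n < length (part k (W e m))" using LeastI_ex[OF that] .
    then show "Phi A (t k e) n = list_limit (\<lambda>m. part k (W e m)) n"
      unfolding t(2)[OF \<open>e \<in> E\<close>] list_limit_def by (simp add: entry_def)
  qed
  have "path_decomposition (C e) (Phi A (t BLUE e)) (Phi A (t RED e))" if "e \<in> E" for e
    unfolding lim[OF that] using good step that by (intro path_decomposition_limit) auto
  moreover have "\<exists>w. H e w \<and> n < length (part k w)" if "e \<in> E" "n \<in> dom (Phi A (t k e))" for e k n
    using that good unfolding lim[OF that(1)] by (auto simp: dom_def list_limit_def split: if_splits)
  ultimately show ?thesis using t(1) by blast
qed

end

subsection \<open>The two cases\<close>

text \<open>Only the values on two-element sets are meaningful; on these it agrees with every coloring of
  which \<open>e\<close> is an index.\<close>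

definition indexed_coloring :: "nat \<Rightarrow> coloring" where
  "indexed_coloring e S = (if phi e (prod_encode (Min S, Max S)) = Some 0 then BLUE else RED)"

lemma phi_indexed_coloring:
  assumes "coloring_index e c" "x < y"
  shows "phi e (prod_encode (x, y)) = Some (color_code (indexed_coloring e {x, y}))"
proof -
  have "phi e (prod_encode (x, y)) = Some (color_code (c {x, y}))"
    using assms by (simp add: coloring_index_def)
  moreover have "Min {x, y} = x" "Max {x, y} = y" using assms(2) by auto
  ultimately show ?thesis by (cases "c {x, y}") (simp_all add: indexed_coloring_def)
qed

lemma indexed_coloring_eq:
  assumes "coloring_index e c" "x \<noteq> y" shows "indexed_coloring e {x, y} = c {x, y}"
proof -
  have *: "indexed_coloring e {x, y} = c {x, y}" if "x < y" for x y
  proof -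
    have "color_code (indexed_coloring e {x, y}) = color_code (c {x, y})"
      using phi_indexed_coloring[OF assms(1) that] assms(1) that by (simp add: coloring_index_def)
    then show ?thesis by (cases "indexed_coloring e {x, y}"; cases "c {x, y}") simp_all
  qed
  show ?thesis
    using *[of x y] *[of y x] assms(2) by (auto simp: nat_neq_iff insert_commute)
qed

text \<open>Injectivity makes consecutive vertices of a path distinct, so only the colors of
  two-element sets matter.\<close>

lemma path_decomposition_cong:
  assumes "\<And>x y. x \<noteq> y \<Longrightarrow> c {x, y} = d {x, y}" "path_decomposition c Pb Pr"
  shows "path_decomposition d Pb Pr"
proof -
  have "path d k P" if P: "path c k P" for k P
    unfolding path_def
  proof (intro conjI allI impI)
    fix n assume n: "Suc n \<in> dom P"
    then have "n \<in> dom P" using P unfolding path_def initial_segment_def by blast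
    then have "the (P n) \<noteq> the (P (Suc n))"
      using P n unfolding path_def by (metis domD inj_onD n_not_Suc_n option.sel)
    moreover have "c {the (P n), the (P (Suc n))} = k" using P n by (simp add: path_def)
    ultimately show "d {the (P n), the (P (Suc n))} = k" using assms(1) by metis
  qed (use P in \<open>auto simp: path_def\<close>)
  then show ?thesis using assms(2) by (simp add: path_decomposition_def)
qed

lemma indexed_coloring_family:
  assumes "\<And>e. e \<in> E \<Longrightarrow> \<exists>c. coloring_index e c"
  shows "coloring_family {} E indexed_coloring"
proof
  fix k
  let ?x = "\<lambda>z. fst (prod_decode z)" and ?y = "\<lambda>z. snd (prod_decode z)"
  \<comment> \<open>The pair is sorted, and equal entries are replaced by \<open>x\<close> and
    \<open>Suc x\<close>: the program is run only where it is known to converge, and the conjunct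
    \<open>?x z \<noteq> ?y z\<close> discards the artificial answer.\<close>
  let ?lo = "\<lambda>z. if ?x z < ?y z then ?x z else ?y z"
  let ?hi = "\<lambda>z. if ?x z < ?y z then ?y z else if ?y z < ?x z then ?x z else Suc (?x z)"
  have "uniformly_computable_in {} E (\<lambda>e z. color_code (indexed_coloring e {?lo z, ?hi z}))"
  proof (rule uc_apply_index)
    show "uniformly_computable_in {} E (\<lambda>e z. prod_encode (?lo z, ?hi z))"
      by (intro uc_pair uc_if ud_less uc_fst uc_snd uc_id uc_Suc)
    show "phi e (prod_encode (?lo z, ?hi z)) = Some (color_code (indexed_coloring e {?lo z, ?hi z}))"
      if "e \<in> E" for e z
    proof -
      have "?lo z < ?hi z" by auto
      then show ?thesis using assms[OF that] phi_indexed_coloring by blast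
    qed
  qed
  then have "uniformly_decidable_in {} E (\<lambda>e z. \<not> ?x z = ?y z \<and>
      color_code (indexed_coloring e {?lo z, ?hi z}) = color_code k)"
    by (intro ud_conj ud_not ud_eq uc_fst uc_snd uc_id uc_const)
  moreover have "color_code a = color_code k \<longleftrightarrow> a = k" for a by (cases a; cases k) auto
  then have "\<not> ?x z = ?y z \<and> color_code (indexed_coloring e {?lo z, ?hi z}) = color_code k \<longleftrightarrow>
      ?x z \<noteq> ?y z \<and> indexed_coloring e {?x z, ?y z} = k" for e z
    by (cases "?x z" "?y z" rule: linorder_cases) (simp_all add: insert_commute)
  ultimately show "uniformly_decidable_in {} E (\<lambda>e z. ?x z \<noteq> ?y z \<and> indexed_coloring e {?x z, ?y z} = k)"
    by (simp only:)
qed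

lemma indexed_coloring_family_jump:
  assumes "\<And>e. e \<in> E \<Longrightarrow> \<exists>c. coloring_index e c"
  shows "coloring_family (jump {}) E indexed_coloring"
  using coloring_family.ud_edge[OF indexed_coloring_family[OF assms]]
  by (intro coloring_family.intro ud_jump_lift)

lemma opposite_neq [simp]: "opposite k \<noteq> k" "k \<noteq> opposite k"
  by (cases k; simp)+

text \<open>An arbitrary color \<open>k\<close> is singled out, so that the two constructions below
  need not be carried out once for each color.\<close>

lemma valid_iff_opposite:
  "valid c w \<longleftrightarrow> monochromatic c k (part k w) \<and> monochromatic c (opposite k) (part (opposite k) w) \<and>
     set (part k w) \<inter> set (part (opposite k) w) = {}"
  unfolding valid_def all_color by (cases k) auto

lemma extends_iff_opposite:
  "extends w w' \<longleftrightarrow> prefix (part k w) (part k w') \<and> prefix (part (opposite k) w) (part (opposite k) w')"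
  unfolding extends_def all_color by (cases k) auto

lemma covers_iff_opposite:
  "covers w m \<longleftrightarrow> m \<in> set (part k w) \<union> set (part (opposite k) w)"
  unfolding covers_def by (cases k) auto

lemma computable_decomposition_finite_path:
  assumes e: "coloring_index e c" and fin: "finite {v. stable (indexed_coloring e) k v}"
  shows "\<exists>Pb Pr. computable_path_decomposition c Pb Pr \<and> (finite (dom Pb) \<or> finite (dom Pr))"
proof -
  let ?c = "indexed_coloring e"
  obtain k Q where Q: "monochromatic ?c k Q" and span: "spanning ?c (opposite k) (set Q)"
    using finite_stable_imp_spanning[OF fin] by blast
  interpret coloring_family "{}" "{e}" indexed_coloring
    using e by (intro indexed_coloring_family) auto
  define H :: "nat \<Rightarrow> nat \<Rightarrow> bool" where "H e w \<longleftrightarrow> part_code k w = list_encode Q" for e w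
  have H: "H e w \<longleftrightarrow> part k w = Q" for e w
    unfolding H_def part_def by (metis list_decode_inverse list_encode_inverse)
  let ?state = "\<lambda>P. state (\<lambda>j. if j = k then Q else P) 0"
  have "\<exists>t. (\<forall>k. computable (t k)) \<and> (\<forall>e\<in>{e}.
      path_decomposition (indexed_coloring e) (phi (t BLUE e)) (phi (t RED e)) \<and>
      (\<forall>k. \<forall>n\<in>dom (phi (t k e)). \<exists>w. H e w \<and> n < length (part k w)))"
  proof (rule decomposition_by_search)
    show "uniformly_decidable_in {} {e} H"
      unfolding H_def by (intro ud_eq uc_part_code uc_const uc_id)
    show "\<exists>w. valid (indexed_coloring e') w \<and> H e' w" if "e' \<in> {e}" for e'
      using that Q by (intro exI[of _ "?state []"]) (simp add: H valid_iff_opposite[of _ _ k])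
    show "\<exists>w'. valid (indexed_coloring e') w' \<and> H e' w' \<and> extends w w' \<and> covers w' m"
      if "e' \<in> {e}" and w: "valid (indexed_coloring e') w" "H e' w" for e' w m
    proof -
      let ?P = "part (opposite k) w"
      have P: "monochromatic ?c (opposite k) ?P" "set ?P \<inter> set Q = {}" and [simp]: "part k w = Q"
        using that by (auto simp: H valid_iff_opposite[of _ _ k])
      have "\<exists>ys. monochromatic ?c (opposite k) (?P @ ys) \<and> set ys \<inter> set Q = {} \<and> m \<in> set Q \<union> set (?P @ ys)"
      proof (cases "m \<in> set Q")
        case True
        then show ?thesis using P by (intro exI[of _ "[]"]) simp
      next
        case False
        then show ?thesis using span P unfolding spanning_def by blast
      qed
      then obtain ys where ys: "monochromatic ?c (opposite k) (?P @ ys)" "set ys \<inter> set Q = {}"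
        "m \<in> set Q \<union> set (?P @ ys)" by blast
      then show ?thesis
        using P Q \<open>e' \<in> {e}\<close>
        by (intro exI[of _ "?state (?P @ ys)"])
           (auto simp: H valid_iff_opposite[of _ _ k] extends_iff_opposite[of _ _ k]
             covers_iff_opposite[of _ _ k])
    qed
  qed
  then obtain t where dec: "path_decomposition ?c (phi (t BLUE e)) (phi (t RED e))"
    and dom: "\<And>j n. n \<in> dom (phi (t j e)) \<Longrightarrow> \<exists>w. H e w \<and> n < length (part j w)" by blast
  have "dom (phi (t k e)) \<subseteq> {..<length Q}" using dom[of _ k] H by auto
  then have "finite (dom (phi (t k e)))" by (rule finite_subset) simp
  then have "finite (dom (phi (t BLUE e))) \<or> finite (dom (phi (t RED e)))" by (cases k) auto
  moreover have "path_decomposition c (phi (t BLUE e)) (phi (t RED e))"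
    using path_decomposition_cong[OF indexed_coloring_eq[OF e] dec] .
  ultimately show ?thesis
    unfolding path_decomposition_in_def partial_computable_in_def by blast
qed

text \<open>For a given bound \<open>n\<close> this has a single universal quantifier, so one jump
  query decides it; plain stability would quantify over the bound too. The form
  \<open>last xs + n + Suc i\<close> differs from \<open>last xs\<close>, so only edges are asked
  about.\<close>

definition settled :: "coloring \<Rightarrow> color \<Rightarrow> nat \<Rightarrow> nat list \<Rightarrow> bool" where
  "settled c k n xs \<longleftrightarrow> xs = [] \<or> (\<forall>i. c {last xs, last xs + n + Suc i} = k)"

lemma settled_mono:
  assumes "settled c k n xs" "n \<le> n'" shows "settled c k n' xs"
proof -
  have "last xs + n' + Suc i = last xs + n + Suc (i + (n' - n))" for i
    using assms(2) by simp
  then show ?thesis using assms(1) unfolding settled_def by metis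
qed

lemma settled_imp_stable:
  assumes "settled c k n xs" shows "xs = [] \<or> stable c k (last xs)"
proof -
  have "x = last xs + n + Suc (x - Suc (last xs + n))" if "x > last xs + n" for x
    using that by simp
  then show ?thesis using assms unfolding settled_def MOST_nat by metis
qed

lemma stable_imp_settled:
  assumes "stable c k (last xs)" shows "\<exists>n. settled c k n xs"
proof -
  obtain n where "\<And>x. x > n \<Longrightarrow> c {last xs, x} = k" using assms unfolding MOST_nat by blast
  then have "settled c k n xs" by (simp add: settled_def)
  then show ?thesis ..
qed

lemma uniform_Delta2_decomposition:
  assumes E: "\<And>e. e \<in> E \<Longrightarrow> \<exists>c. coloring_index e c"
    and inf: "\<And>e k. e \<in> E \<Longrightarrow> infinite {v. stable (indexed_coloring e) k v}"
  shows "\<exists>t. (\<forall>k. computable (t k)) \<and> (\<forall>e\<in>E. path_decomposition (indexed_coloring e)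
      (Phi (jump {}) (t BLUE e)) (Phi (jump {}) (t RED e)))"
proof -
  \<comment> \<open>The search over states uses the oracle, whereas the predicate inside a jump
    query has to be decidable without it.\<close>
  interpret J: coloring_family "jump {}" E indexed_coloring
    using E by (rule indexed_coloring_family_jump)
  interpret coloring_family "{}" E indexed_coloring
    using E by (rule indexed_coloring_family)
  define bound where "bound w = snd (prod_decode (snd (prod_decode w)))" for w
  have [simp]: "bound (state L n) = n" for L n by (simp add: bound_def state_def)
  define H where "H e w \<longleftrightarrow> (\<forall>k. settled (indexed_coloring e) k (bound w) (part k w))" for e w
  have "\<exists>t. (\<forall>k. computable (t k)) \<and> (\<forall>e\<in>E.
      path_decomposition (indexed_coloring e) (Phi (jump {}) (t BLUE e)) (Phi (jump {}) (t RED e)) \<and>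
      (\<forall>k. \<forall>n\<in>dom (Phi (jump {}) (t k e)). \<exists>w. H e w \<and> n < length (part k w)))"
  proof (rule J.decomposition_by_search)
    \<comment> \<open>For the empty list this is the default 0; the disjunct on the length covers
      that case.\<close>
    let ?last = "\<lambda>k w. entry (list_decode (part_code k w)) (length (list_decode (part_code k w)) - 1)"
    have "uniformly_decidable_in (jump {}) E (\<lambda>e w. length (list_decode (part_code k w)) = 0 \<or>
       \<not> (\<exists>i. \<not> (?last k w \<noteq> ?last k w + snd (prod_decode (snd (prod_decode w))) + Suc i \<and>
         indexed_coloring e {?last k w, ?last k w + snd (prod_decode (snd (prod_decode w))) + Suc i} = k)))" for k
      by (intro ud_disj ud_eq_0 ud_not ud_jump ud_edge' uc_length uc_entry uc_pred uc_part_code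
          uc_add uc_Suc uc_fst uc_snd uc_id)
    then have "uniformly_decidable_in (jump {}) E (\<lambda>e w. settled (indexed_coloring e) k (bound w) (part k w))" for k
      by (rule ud_cong) (auto simp: settled_def part_def bound_def entry_def last_conv_nth)
    then show "uniformly_decidable_in (jump {}) E H"
      unfolding H_def all_color by (intro ud_conj)
    show "\<exists>w. valid (indexed_coloring e) w \<and> H e w" if "e \<in> E" for e
      by (rule exI[of _ "state (\<lambda>_. []) 0"]) (simp add: H_def valid_def settled_def)
    show "\<exists>w'. valid (indexed_coloring e) w' \<and> H e w' \<and> extends w w' \<and> covers w' m"
      if e: "e \<in> E" and w: "valid (indexed_coloring e) w" "H e w" for e w m
    proof (cases "covers w m")
      case True
      then show ?thesis using w by (intro exI[of _ w]) (simp add: extends_def)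
    next
      case False
      let ?c = "indexed_coloring e"
      \<comment> \<open>If \<open>m\<close> is not stable in \<open>BLUE\<close>, it has infinitely
        many neighbors in \<open>RED\<close>; otherwise almost all its edges are
        \<open>BLUE\<close>.\<close>
      obtain k where k: "INFM x. ?c {m, x} = k"
        using not_stable[of ?c m BLUE] MOST_INFM[OF infinite_UNIV_nat] by blast
      let ?xs = "part k w" and ?zs = "part (opposite k) w"
      have m: "m \<notin> set ?xs" "m \<notin> set ?zs"
        using False by (auto simp: covers_iff_opposite[of _ _ k])
      have val: "monochromatic ?c k ?xs" "monochromatic ?c (opposite k) ?zs" "set ?xs \<inter> set ?zs = {}"
        using w(1) by (auto simp: valid_iff_opposite[of _ _ k])
      have xs: "settled ?c k (bound w) ?xs" and zs: "settled ?c (opposite k) (bound w) ?zs"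
        using w(2) by (auto simp: H_def)
      obtain ys where ys: "monochromatic ?c k (?xs @ ys)" "m \<in> set ys" "set ys \<inter> set ?zs = {}"
        "stable ?c k (last (?xs @ ys))"
        using extend_stable[OF val(1) settled_imp_stable[OF xs] k m finite_set inf[OF e]] .
      obtain n where n: "settled ?c k n (?xs @ ys)" using stable_imp_settled[OF ys(4)] by blast
      \<comment> \<open>Both ends share one bound. Taking the maximum suits the new end and keeps
        the untouched path settled.\<close>
      let ?w = "state (\<lambda>j. if j = k then ?xs @ ys else ?zs) (max (bound w) n)"
      have "valid ?c ?w" using ys val by (auto simp: valid_iff_opposite[of _ _ k])
      moreover have "extends w ?w" by (simp add: extends_iff_opposite[of _ _ k])
      moreover have "covers ?w m" using ys(2) by (simp add: covers_iff_opposite[of _ _ k])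
      moreover have "H e ?w"
        using settled_mono[OF n, of "max (bound w) n"] settled_mono[OF zs, of "max (bound w) n"]
        by (auto simp: H_def neq_iff_opposite)
      ultimately show ?thesis by blast
    qed
  qed
  then show ?thesis by blast
qed

theorem theorem6:
  "\<exists>f. computable f \<and>
     (\<forall>e c. coloring_index e c \<longrightarrow>
        Delta2_path_decomposition_index (f e) c \<or>
        (\<exists>Pb Pr. computable_path_decomposition c Pb Pr \<and>
           (finite (dom Pb) \<or> finite (dom Pr))))"
proof -
  \<comment> \<open>Membership in \<open>E\<close> need not be decidable: the same \<open>t\<close>
    is used for all \<open>e\<close>, and an index outside \<open>E\<close> falls under the second
    alternative.\<close>
  define E where "E = {e. (\<exists>c. coloring_index e c) \<and> (\<forall>k. infinite {v. stable (indexed_coloring e) k v})}"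
  have "\<exists>t. (\<forall>k. computable (t k)) \<and> (\<forall>e\<in>E. path_decomposition (indexed_coloring e)
      (Phi (jump {}) (t BLUE e)) (Phi (jump {}) (t RED e)))"
    by (rule uniform_Delta2_decomposition) (simp_all add: E_def)
  then obtain t where t: "\<And>k. computable (t k)" and dec: "\<And>e. e \<in> E \<Longrightarrow>
      path_decomposition (indexed_coloring e) (Phi (jump {}) (t BLUE e)) (Phi (jump {}) (t RED e))"
    by blast
  have "computable (\<lambda>e. prod_encode (t BLUE e, t RED e))"
    by (intro computable_pair t)
  moreover have "Delta2_path_decomposition_index (prod_encode (t BLUE e, t RED e)) c \<or>
      (\<exists>Pb Pr. computable_path_decomposition c Pb Pr \<and> (finite (dom Pb) \<or> finite (dom Pr)))"
    if e: "coloring_index e c" for e c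
  proof (cases "e \<in> E")
    case True
    then have "path_decomposition c (Phi (jump {}) (t BLUE e)) (Phi (jump {}) (t RED e))"
      using path_decomposition_cong[OF indexed_coloring_eq[OF e] dec] by blast
    then show ?thesis
      unfolding Delta2_path_decomposition_index_def path_decomposition_in_def
        partial_computable_in_def by blast
  next
    case False
    then obtain k where "finite {v. stable (indexed_coloring e) k v}"
      using e by (auto simp: E_def)
    then show ?thesis using computable_decomposition_finite_path[OF e] by blast
  qed
  ultimately show ?thesis by blast
qed

end
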